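(* Let $\lambda,\mu\in\mathbb{C}$ with $\lambda\neq 1$, $\mu\neq 1$, let $r,k\in\mathbb{Z}$, $s\in\mathbb{Z}_{\geq 0}$ and $n\ge 0$. Then \[ T_{n}^{(r,k)}(x|\lambda)=\frac{1}{(1-\mu)^{s}}\sum_{m=0}^{n}\left\{\binom{n}{m}\sum_{j=0}^{s}\binom{s}{j}(-\mu)^{s-j}T_{n-m}^{(r,k)}(j|\lambda) \right\} H_{m}^{(s)}(x|\mu). \]
   Context: For $k\in\mathbb{Z}$, $Li_k(x)=\sum_{n\ge1}x^n/n^k$. For $r,k\in\mathbb{Z}$ the polynomials $T_n^{(r,k)}(x|\lambda)$ are defined by $\left(\frac{1-\lambda}{e^t-\lambda}\right)^r\frac{Li_{k}(1-e^{-t})}{1-e^{-t}}e^{xt}=\sum_{n\ge0}T_n^{(r,k)}(x|\lambda)\frac{t^n}{n!}$ (as formal power series in $t$). The Frobenius-Euler polynomials of order $s$ with parameter $\mu$ are defined by $\left(\frac{1-\mu}{e^t-\mu}\right)^{s}e^{xt}=\sum_{n\ge0}H_n^{(s)}(x|\mu)\frac{t^n}{n!}$. *)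

theory Defs
  imports "HOL-Analysis.Analysis" "HOL-Computational_Algebra.Computational_Algebra"
begin

definition polylog_fps :: "int \<Rightarrow> complex fps" where
  "polylog_fps k = Abs_fps (\<lambda>n. if n = 0 then 0 else 1 / (of_nat n powi k))"

text \<open>
  \<open>Li\<^sub>k(1 - e\<^sup>-\<^sup>t) / (1 - e\<^sup>-\<^sup>t)\<close> as a formal power series in \<open>t\<close>. The denominator has zero
  constant term, so this is an exact quotient in the ring of power series rather than
  multiplication by an inverse; see \<open>poly_bernoulli_fps_mult\<close> below.
\<close>

definition poly_bernoulli_fps :: "int \<Rightarrow> complex fps" where
  "poly_bernoulli_fps k =
     (polylog_fps k oo (1 - fps_exp (-1))) / (1 - fps_exp (-1))"

text \<open>
  \<open>(1 - \<mu>) / (e\<^sup>t - \<mu>)\<close>, a unit of the ring of power series when \<open>\<mu> \<noteq> 1\<close>, so that integer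
  powers of it are meaningful.
\<close>

definition frobenius_euler_fps :: "complex \<Rightarrow> complex fps" where
  "frobenius_euler_fps \<mu> = fps_const (1 - \<mu>) / (fps_exp 1 - fps_const \<mu>)"

text \<open>
  \<open>T n r k x lam\<close> is the value at \<open>x\<close> of the polynomial \<open>T\<^sub>n\<^sup>(\<^sup>r\<^sup>,\<^sup>k\<^sup>)(x|lam)\<close>, and \<open>H n s x \<mu>\<close> that
  of the Frobenius-Euler polynomial \<open>H\<^sub>n\<^sup>(\<^sup>s\<^sup>)(x|\<mu>)\<close>: \<open>n!\<close> times the coefficient of \<open>t\<^sup>n\<close> in the
  respective generating function.
\<close>

definition T :: "nat \<Rightarrow> int \<Rightarrow> int \<Rightarrow> complex \<Rightarrow> complex \<Rightarrow> complex" where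
  "T n r k x lam =
     fact n * fps_nth (frobenius_euler_fps lam powi r * poly_bernoulli_fps k * fps_exp x) n"

definition H :: "nat \<Rightarrow> nat \<Rightarrow> complex \<Rightarrow> complex \<Rightarrow> complex" where
  "H n s x \<mu> = fact n * fps_nth (frobenius_euler_fps \<mu> ^ s * fps_exp x) n"

lemma poly_bernoulli_fps_mult:
  "poly_bernoulli_fps k * (1 - fps_exp (-1)) = polylog_fps k oo (1 - fps_exp (-1))"
proof -
  let ?g = "1 - fps_exp (-1) :: complex fps"
  have g1: "fps_nth ?g 1 \<noteq> 0" and g0: "fps_nth ?g 0 = 0"
    by simp_all
  have sd: "subdegree ?g = 1"
    by (rule subdegreeI) (use g1 g0 in auto)
  have "fps_nth (polylog_fps k oo ?g) 0 = 0"
    by (simp add: fps_compose_nth polylog_fps_def)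
  hence le: "subdegree ?g \<le> subdegree (polylog_fps k oo ?g)" if "polylog_fps k oo ?g \<noteq> 0"
    using that sd by (metis less_one not_le nth_subdegree_nonzero)
  have "?g \<noteq> 0"
    using g1 by (metis fps_zero_nth)
  hence "?g dvd (polylog_fps k oo ?g)"
    by (cases "polylog_fps k oo ?g = 0") (metis dvd_0_right, metis fps_dvd_iff le)
  thus ?thesis
    unfolding poly_bernoulli_fps_def by (rule dvd_div_mult_self)
qed

lemma frobenius_euler_fps_mult:
  assumes "\<mu> \<noteq> 1"
  shows "frobenius_euler_fps \<mu> * (fps_exp 1 - fps_const \<mu>) = fps_const (1 - \<mu>)"
proof -
  have "fps_nth (fps_exp 1 - fps_const \<mu>) 0 \<noteq> 0"
    using assms by simp
  hence "is_unit (fps_exp 1 - fps_const \<mu>)"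
    by (simp only: fps_is_unit_iff not_False_eq_True)
  thus ?thesis
    unfolding frobenius_euler_fps_def
    by (meson dvd_div_mult_self unit_imp_dvd)
qed

lemma fact_nth_mult_fps_exp_poly:
  "\<exists>p. \<forall>x. fact n * fps_nth (F * fps_exp x) n = poly p (x :: complex)"
  by (rule exI[of _ "\<Sum>i=0..n. monom (fact n * fps_nth F i / fact (n - i)) (n - i)"])
     (simp add: fps_mult_nth poly_sum poly_monom sum_distrib_left mult_ac)

lemma T_poly: "\<exists>p. \<forall>x. T n r k x lam = poly p x"
  unfolding T_def by (rule fact_nth_mult_fps_exp_poly)

lemma H_poly: "\<exists>p. \<forall>x. H n s x \<mu> = poly p x"
  unfolding H_def by (rule fact_nth_mult_fps_exp_poly)

end

(* Since (1 - mu)/(e^t - mu) is a unit, the generating function of T at x is (1 - mu)^(-s) times the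
   product of G (e^t - mu)^s with ((1 - mu)/(e^t - mu))^s e^(xt), where G generates T at 0. The binomial
   theorem expands the first factor into generating functions of T at x = 0, ..., s; compare coefficients. *)
theory Submission
  imports Defs
begin

text \<open>Cauchy product of exponential generating functions. Commuting the factors first gives
  \<open>B\<close> the index \<open>m\<close> and \<open>A\<close> the index \<open>n - m\<close>,
  the arrangement needed when \<open>B\<close> generates \<open>H\<close>.\<close>

lemma fact_nth_mult_fps:
  fixes A B :: "'a :: field_char_0 fps"
  shows "fact n * fps_nth (A * B) n =
    (\<Sum>m=0..n. of_nat (n choose m) * (fact (n - m) * fps_nth A (n - m)) * (fact m * fps_nth B m))"
  unfolding mult.commute[of A B] fps_mult_nth sum_distrib_left
  by (rule sum.cong) (simp_all add: binomial_fact)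

text \<open>Binomial theorem together with (e^t)^j = e^(jt). In this form each summand is a constant
  times an exponential, which shifts the argument of \<open>T\<close> to \<open>j\<close>.\<close>

lemma fps_exp_minus_const_power:
  fixes \<mu> :: "'a :: field_char_0"
  shows "(fps_exp 1 - fps_const \<mu>) ^ s =
    (\<Sum>j=0..s. fps_const (of_nat (s choose j) * (- \<mu>) ^ (s - j)) * fps_exp (of_nat j))"
proof -
  have "(fps_exp 1 - fps_const \<mu>) ^ s = (fps_exp 1 + fps_const (- \<mu>)) ^ s"
    by (simp flip: fps_const_neg)
  also have "\<dots> = (\<Sum>j\<le>s. of_nat (s choose j) * fps_exp 1 ^ j * fps_const (- \<mu>) ^ (s - j))"
    by (rule binomial_ring)
  also have "\<dots> = (\<Sum>j=0..s. fps_const (of_nat (s choose j) * (- \<mu>) ^ (s - j)) * fps_exp (of_nat j))"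
    unfolding atMost_atLeast0
    by (rule sum.cong)
       (simp_all add: fps_exp_power_mult fps_const_power fps_of_nat mult_ac
                 flip: fps_const_mult)
  finally show ?thesis .
qed

theorem theorem8:
  fixes lam \<mu> x :: complex and r k :: int and s n :: nat
  assumes "lam \<noteq> 1" and "\<mu> \<noteq> 1"
  shows "T n r k x lam =
    1 / (1 - \<mu>) ^ s *
      (\<Sum>m=0..n.
        (of_nat (n choose m) *
          (\<Sum>j=0..s. of_nat (s choose j) * (- \<mu>) ^ (s - j) * T (n - m) r k (of_nat j) lam))
        * H m s x \<mu>)"
proof -
  define G where "G = frobenius_euler_fps lam powi r * poly_bernoulli_fps k"
  define A where "A = G * (fps_exp 1 - fps_const \<mu>) ^ s"
  \<comment> \<open>Distributing \<open>G\<close> over the binomial expansion leaves the series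
    \<open>G * fps_exp (of_nat j)\<close>, which generates \<open>T\<close> at
    \<open>j\<close>.\<close>
  have A: "fact i * fps_nth A i =
      (\<Sum>j=0..s. of_nat (s choose j) * (- \<mu>) ^ (s - j) * T i r k (of_nat j) lam)" for i
    unfolding A_def fps_exp_minus_const_power T_def G_def[symmetric] sum_distrib_left fps_sum_nth
      mult.left_commute[of G] fps_mult_left_const_nth
    by (simp add: mult_ac)
  \<comment> \<open>The powers of e^t - \<mu> in \<open>A\<close> cancel the denominators in the
    series of \<open>H\<close>, leaving only the constant (1 - \<mu>)^s.\<close>
  have "A * (frobenius_euler_fps \<mu> ^ s * fps_exp x) =
      (frobenius_euler_fps \<mu> * (fps_exp 1 - fps_const \<mu>)) ^ s * (G * fps_exp x)"
    by (simp add: A_def power_mult_distrib mult_ac)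
  also have "\<dots> = fps_const ((1 - \<mu>) ^ s) * (G * fps_exp x)"
    by (simp only: frobenius_euler_fps_mult[OF assms(2)] fps_const_power)
  finally have "(1 - \<mu>) ^ s * T n r k x lam =
      fact n * fps_nth (A * (frobenius_euler_fps \<mu> ^ s * fps_exp x)) n"
    by (simp only: fps_mult_left_const_nth T_def G_def mult.left_commute[of "fact n"])
  also have "\<dots> = (\<Sum>m=0..n.
        (of_nat (n choose m) *
          (\<Sum>j=0..s. of_nat (s choose j) * (- \<mu>) ^ (s - j) * T (n - m) r k (of_nat j) lam))
        * H m s x \<mu>)"
    unfolding fact_nth_mult_fps A H_def ..
  finally show ?thesis
    \<comment> \<open>As \<mu> differs from 1, the factor (1 - \<mu>)^s can be divided out.\<close>
    using assms(2) by (simp add: field_simps)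
qed

end
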